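(* There exists a connected matroid $\mathsf{M}$ on a ground set of cardinality $20$, of rank $9$, having exactly $159562$ bases, such that its base polytope $\mathscr{P}(\mathsf{M})$ is not Ehrhart positive.
   Context: For a matroid $\mathsf{M}$ on $E=\{1,\ldots,n\}$ with set of bases $\mathscr{B}$, the base polytope is $\mathscr{P}(\mathsf{M})=\operatorname{conv}\{e_B : B\in\mathscr{B}\}\subseteq\mathbb{R}^n$, where $e_B=\sum_{i\in B}e_i$ and $e_i$ is the $i$-th canonical basis vector. The Ehrhart polynomial of a lattice polytope $\mathscr{P}\subseteq\mathbb{R}^n$ is the polynomial $\operatorname{ehr}(\mathscr{P},t)$ of degree $\dim\mathscr{P}$ with $\operatorname{ehr}(\mathscr{P},t)=\#(t\mathscr{P}\cap\mathbb{Z}^n)$ for all nonnegative integers $t$. The polytope $\mathscr{P}$ is Ehrhart positive if all coefficients of $\operatorname{ehr}(\mathscr{P},t)$ (in degrees $0,\ldots,\dim\mathscr{P}$) are positive. A matroid is connected if for every pair of distinct elements of the ground set there is a circuit containing both. *)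

theory Defs
  imports "HOL-Analysis.Analysis" "HOL-Computational_Algebra.Polynomial"
begin

definition matroid :: "'a set \<Rightarrow> 'a set set \<Rightarrow> bool" where
  "matroid E \<B> \<longleftrightarrow>
     finite E \<and> \<B> \<noteq> {} \<and> (\<forall>B\<in>\<B>. B \<subseteq> E) \<and>
     (\<forall>A\<in>\<B>. \<forall>B\<in>\<B>. \<forall>a\<in>A - B. \<exists>b\<in>B - A. insert b (A - {a}) \<in> \<B>)"

definition matroid_indep :: "'a set set \<Rightarrow> 'a set \<Rightarrow> bool" where
  "matroid_indep \<B> I \<longleftrightarrow> (\<exists>B\<in>\<B>. I \<subseteq> B)"

definition matroid_circuit :: "'a set \<Rightarrow> 'a set set \<Rightarrow> 'a set \<Rightarrow> bool" where
  "matroid_circuit E \<B> C \<longleftrightarrow>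
     C \<subseteq> E \<and> \<not> matroid_indep \<B> C \<and> (\<forall>D. D \<subset> C \<longrightarrow> matroid_indep \<B> D)"

definition matroid_rank :: "'a set \<Rightarrow> 'a set set \<Rightarrow> nat" where
  "matroid_rank E \<B> = Max (card ` {I. I \<subseteq> E \<and> matroid_indep \<B> I})"

definition matroid_connected :: "'a set \<Rightarrow> 'a set set \<Rightarrow> bool" where
  "matroid_connected E \<B> \<longleftrightarrow>
     (\<forall>x\<in>E. \<forall>y\<in>E. x \<noteq> y \<longrightarrow> (\<exists>C. matroid_circuit E \<B> C \<and> x \<in> C \<and> y \<in> C))"

text \<open>The coordinates are indexed by the elements of the type, so this is the base polytope
  of a matroid whose ground set is all of \<^typ>\<open>'n::finite\<close>.\<close>

definition base_polytope :: "'n::finite set set \<Rightarrow> (real ^ 'n) set" where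
  "base_polytope \<B> = convex hull ((\<lambda>B. \<Sum>i\<in>B. axis i 1) ` \<B>)"

definition lattice_points :: "(real ^ 'n::finite) set" where
  "lattice_points = {x. \<forall>i. x $ i \<in> \<int>}"

definition is_ehrhart_poly :: "(real ^ 'n::finite) set \<Rightarrow> real poly \<Rightarrow> bool" where
  "is_ehrhart_poly P p \<longleftrightarrow>
     int (degree p) = aff_dim P \<and>
     (\<forall>t::nat. poly p (real t) = real (card ((*\<^sub>R) (real t) ` P \<inter> lattice_points)))"

text \<open>Uniqueness holds for every \<open>P\<close>; existence is Ehrhart's theorem and holds when \<open>P\<close> is
  a nonempty lattice polytope. For other \<open>P\<close> the value of \<open>ehrhart_poly P\<close> may be
  unspecified.\<close>

lemma is_ehrhart_poly_unique:
  assumes "is_ehrhart_poly P p" and "is_ehrhart_poly P q"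
  shows "p = q"
proof (rule ccontr)
  assume "p \<noteq> q"
  then have "finite {x. poly (p - q) x = 0}"
    by (intro poly_roots_finite) simp
  moreover have "range real \<subseteq> {x. poly (p - q) x = 0}"
    using assms by (auto simp: is_ehrhart_poly_def)
  ultimately have "finite (range real)"
    by (rule rev_finite_subset)
  then show False
    by (simp add: finite_image_iff inj_on_def)
qed

definition ehrhart_poly :: "(real ^ 'n::finite) set \<Rightarrow> real poly" where
  "ehrhart_poly P = (THE p. is_ehrhart_poly P p)"

definition ehrhart_positive :: "(real ^ 'n::finite) set \<Rightarrow> bool" where
  "ehrhart_positive P \<longleftrightarrow> (\<forall>i. int i \<le> aff_dim P \<longrightarrow> coeff (ehrhart_poly P) i > 0)"

end

theory Submission
  imports Defs "HOL-Computational_Algebra.Formal_Power_Series"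
begin

text \<open>The nine-element subsets of \<open>\<int>/20\<close> with sum zero pairwise meet in at most seven elements,
  and by translation they are exactly one twentieth of all nine-element subsets. Removing them from
  the bases of the uniform matroid therefore gives a sparse paving matroid with
  \<open>167960 - 8398 = 159562\<close> bases. Its base polytope is the hypersimplex cut by one inequality
  \<open>x(H) \<le> 8\<close> for each removed set \<open>H\<close>. The corners cut off are pairwise disjoint, and in the
  \<open>t\<close>-th dilation each contains \<open>\<Sum>s<t. C(s+8,8) C(s+10,10)\<close> lattice points, so the Ehrhart
  polynomial is that of the hypersimplex minus \<open>8398\<close> times this one, and its quadratic
  coefficient is negative.\<close>

section \<open>Counting compositions\<close>

text \<open>Multiplying out picks an exponent \<open>y i\<close> from every factor.
  \<open>extensional A\<close> gives each choice exactly one representative, so that cardinalities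
  of sets of compositions become coefficients of products.\<close>

lemma fps_prod_nth_PiE:
  fixes f :: "'a \<Rightarrow> 'b::comm_semiring_1 fps"
  assumes "finite A"
  shows "fps_nth (\<Prod>i\<in>A. f i) m = (\<Sum>y | y \<in> extensional A \<and> sum y A = m. \<Prod>i\<in>A. fps_nth (f i) (y i))"
  using assms
proof (induction A arbitrary: m)
  case empty
  then show ?case
    by (auto simp: fps_one_nth)
next
  case (insert a A)
  let ?Y = "\<lambda>A m. {y :: 'a \<Rightarrow> nat. y \<in> extensional A \<and> sum y A = m}"
  have fin: "finite (?Y A m)" for m
  proof (rule finite_subset)
    show "?Y A m \<subseteq> A \<rightarrow>\<^sub>E {..m}"
      using insert.hyps by (auto simp: PiE_def intro: member_le_sum)
  qed (use insert.hyps in \<open>auto intro: finite_PiE\<close>)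
  have sum_upd: "(\<Sum>i\<in>A. if i = a then j else y i) = sum y A" for y j
    using insert.hyps by (intro sum.cong) auto
  have prod_upd: "(\<Prod>i\<in>A. fps_nth (f i) (if i = a then j else y i)) = (\<Prod>i\<in>A. fps_nth (f i) (y i))" for y j
    using insert.hyps by (intro prod.cong) auto
  have "(\<Sum>y\<in>?Y (insert a A) m. \<Prod>i\<in>insert a A. fps_nth (f i) (y i)) =
      (\<Sum>(j, y)\<in>Sigma {..m} (\<lambda>j. ?Y A (m - j)). fps_nth (f a) j * (\<Prod>i\<in>A. fps_nth (f i) (y i)))"
    \<comment> \<open>Split off the exponent at \<open>a\<close>. Resetting that value to
      \<open>undefined\<close> puts the remaining function back into
      \<open>extensional A\<close>.\<close>
    by (rule sum.reindex_bij_witness[where i = "\<lambda>(j, y). y(a := j)"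
          and j = "\<lambda>y. (y a, y(a := undefined))"])
      (use insert.hyps in \<open>auto simp: extensional_def sum_upd prod_upd intro!: ext\<close>)
  then show ?case
    using insert by (simp add: fps_mult_nth sum.Sigma fin sum_distrib_left atLeast0AtMost)
qed


text \<open>Stars and bars, read off from the coefficients of 1/(1 - X)^(d+1).\<close>

lemma card_weak_compositions:
  assumes "finite A" "card A = Suc d"
  shows "card {y \<in> extensional A. sum y A = s} = (s + d) choose d"
proof -
  have fps: "Abs_fps (\<lambda>_. 1) = inverse (1 - fps_X :: real fps)"
    using fps_inverse_gp'[where 'a = real] fps_inverse_idempotent[of "Abs_fps (\<lambda>_. 1 :: real)"]
    by simp
  have "real (card {y \<in> extensional A. sum y A = s}) =
      fps_nth (\<Prod>i\<in>A. Abs_fps (\<lambda>_. 1)) s"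
    using assms by (subst fps_prod_nth_PiE) auto
  also have "\<dots> = fps_nth (inverse ((1 - fps_const 1 * fps_X) ^ Suc d)) s"
    by (simp add: fps assms fps_inverse_power del: power_Suc)
  also have "\<dots> = (d + s) choose s"
    by (subst one_minus_const_fps_X_neg_power') auto
  finally show ?thesis
    by (simp add: add.commute binomial_symmetric[of s])
qed

text \<open>The generating function is ((1 - X^(t+1)) / (1 - X))^n with n = \<open>CARD('n)\<close>.
  Term \<open>j\<close> comes from the binomial expansion of the numerator; the guard keeps the
  subtraction in \<open>nat\<close> exact.\<close>

lemma card_bounded_compositions:
  fixes t m :: nat
  shows "real (card {y :: 'n::finite \<Rightarrow> nat. (\<forall>i. y i \<le> t) \<and> sum y UNIV = m}) =
    (\<Sum>j\<le>CARD('n). if j * Suc t \<le> m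
       then (- 1 :: real) ^ j * (CARD('n) choose j) *
         ((m - j * Suc t + CARD('n) - 1) choose (CARD('n) - 1)) else 0)"
proof -
  let ?n = "CARD('n)"
  let ?f = "\<Sum>i\<le>t. fps_X ^ i :: real fps"
  have fin: "finite {y :: 'n \<Rightarrow> nat. sum y UNIV = m}"
  proof (rule finite_subset)
    show "{y :: 'n \<Rightarrow> nat. sum y UNIV = m} \<subseteq> UNIV \<rightarrow>\<^sub>E {..m}"
      by (auto simp: PiE_def intro: member_le_sum)
  qed (auto intro: finite_PiE)
  have f_nth: "fps_nth ?f i = of_bool (i \<le> t)" for i
    by (simp add: fps_sum_nth of_bool_def)
  have "real (card {y :: 'n \<Rightarrow> nat. (\<forall>i. y i \<le> t) \<and> sum y UNIV = m}) =
      (\<Sum>y | sum y UNIV = m. of_bool (\<forall>i :: 'n. y i \<le> t))"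
    using fin by (simp add: of_bool_def sum.If_cases Int_def conj_commute)
  also have "\<dots> = fps_nth (\<Prod>i\<in>(UNIV :: 'n set). ?f) m"
    by (subst fps_prod_nth_PiE) (auto simp: f_nth of_bool_def intro!: sum.cong)
  also have "(\<Prod>i\<in>(UNIV :: 'n set). ?f) = (1 - fps_X ^ Suc t) ^ ?n * inverse ((1 - fps_X) ^ ?n)"
  proof -
    have "?f * (1 - fps_X) = 1 - fps_X ^ Suc t"
      using one_diff_power_eq'[of "fps_X :: real fps" "Suc t"]
      by (simp add: sum_gp_basic lessThan_Suc_atMost mult.commute del: power_Suc)
    moreover have "(1 - fps_X) * inverse (1 - fps_X :: real fps) = 1"
      by (simp add: inverse_mult_eq_1')
    ultimately have "?f = (1 - fps_X ^ Suc t) * inverse (1 - fps_X)"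
      by (metis mult.assoc mult.right_neutral)
    then show ?thesis
      by (simp add: power_mult_distrib fps_inverse_power del: power_Suc)
  qed
  also have "(1 - fps_X ^ Suc t :: real fps) ^ ?n =
      (\<Sum>j\<le>?n. fps_const ((- 1) ^ j * (?n choose j)) * fps_X ^ (j * Suc t))"
  proof -
    have "fps_const ((- 1) ^ j) = (- 1 :: real fps) ^ j" for j
      by (simp flip: fps_const_power fps_const_neg)
    then have "of_nat (?n choose j) * (- (fps_X ^ Suc t)) ^ j =
        fps_const ((- 1) ^ j * (?n choose j)) * (fps_X :: real fps) ^ (j * Suc t)" for j
      by (subst power_minus)
        (simp add: fps_of_nat mult_ac flip: power_mult fps_const_mult del: power_Suc)
    then show ?thesis
      using binomial_ring[of "- (fps_X ^ Suc t) :: real fps" 1 ?n] by simp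
  qed
  also have "inverse ((1 - fps_X) ^ ?n) = Abs_fps (\<lambda>k. real ((k + ?n - 1) choose (?n - 1)))"
  proof -
    have "(?n + k - 1) choose k = (k + ?n - 1) choose (?n - 1)" for k
      by (subst binomial_symmetric) (auto simp: add.commute)
    then show ?thesis
      using one_minus_const_fps_X_neg_power'[of ?n "1 :: real"] by simp
  qed
  finally show ?thesis
    by (auto simp: sum_distrib_right fps_sum_nth mult.assoc fps_X_power_mult_nth intro!: sum.cong)
qed

text \<open>For total \<open>k * t\<close> the guard disappears: terms with j \<ge> k have j(t+1) >
  kt, and for j < k a failing guard pushes the upper entry of the binomial below n - 1, where it
  vanishes. Without the guard every summand can be treated as a polynomial in
  \<open>t\<close>.\<close>

lemma card_hypersimplex_points:
  fixes k t :: nat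
  assumes "0 < k" "k \<le> CARD('n)"
  shows "real (card {y :: 'n::finite \<Rightarrow> nat. (\<forall>i. y i \<le> t) \<and> sum y UNIV = k * t}) =
    (\<Sum>j<k. (- 1 :: real) ^ j * (CARD('n) choose j) *
       (((k - j) * t + CARD('n) - 1 - j) choose (CARD('n) - 1)))"
proof -
  let ?n = "CARD('n)"
  let ?g = "\<lambda>j. if j * Suc t \<le> k * t
       then (- 1 :: real) ^ j * (?n choose j) * ((k * t - j * Suc t + ?n - 1) choose (?n - 1)) else 0"
  have "(\<Sum>j\<le>?n. ?g j) = (\<Sum>j<k. ?g j)"
  proof (rule sum.mono_neutral_right)
    show "\<forall>j\<in>{..?n} - {..<k}. ?g j = 0"
    proof
      fix j assume "j \<in> {..?n} - {..<k}"
      then have "k * t < j * Suc t"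
        using assms by (metis DiffE lessThan_iff less_Suc_eq linorder_not_less mult_le_mono1
            mult_less_cancel1 order_less_le_trans)
      then show "?g j = 0"
        by simp
    qed
  qed (use assms in auto)
  also have "\<dots> = (\<Sum>j<k. (- 1 :: real) ^ j * (?n choose j) *
      (((k - j) * t + ?n - 1 - j) choose (?n - 1)))"
  proof (intro sum.cong refl)
    fix j assume "j \<in> {..<k}"
    then obtain l where l: "k = j + l" "0 < l"
      by (auto simp: less_iff_Suc_add)
    show "?g j = (- 1 :: real) ^ j * (?n choose j) * (((k - j) * t + ?n - 1 - j) choose (?n - 1))"
    proof (cases "j \<le> l * t")
      case True
      then have "k * t - j * Suc t + ?n - 1 = (k - j) * t + ?n - 1 - j" "j * Suc t \<le> k * t"
        by (auto simp: l algebra_simps)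
      then show ?thesis
        by simp
    next
      case False
      then have "(k - j) * t + ?n - 1 - j < ?n - 1" "\<not> j * Suc t \<le> k * t"
        using assms l by (auto simp: algebra_simps)
      then show ?thesis
        by (simp add: binomial_eq_0)
    qed
  qed
  finally show ?thesis
    by (simp add: card_bounded_compositions)
qed

section \<open>Sparse paving matroids\<close>

text \<open>\<open>\<H>\<close> is the family of circuit-hyperplanes, the k-sets that are not bases.
  \<open>k_le\<close> leaves three elements outside each k-set, which serves connectivity and the
  dimension count.\<close>

locale sparse_paving =
  fixes k :: nat and \<H> :: "'n::finite set set"
  assumes card_\<H>: "H \<in> \<H> \<Longrightarrow> card H = k"
    and card_Int_\<H>: "\<lbrakk>H \<in> \<H>; H' \<in> \<H>; H \<noteq> H'\<rbrakk> \<Longrightarrow> card (H \<inter> H') + 2 \<le> k"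
    and two_le_k: "2 \<le> k"
    and k_le: "k + 3 \<le> CARD('n)"
begin

section \<open>Matroid axioms, rank and connectivity\<close>

definition bases :: "'n set set" where
  "bases = {B. card B = k} - \<H>"

text \<open>Two such members of \<open>\<H>\<close> would meet in the k - 1 elements of
  \<open>I\<close>. The matroid arguments use \<open>card_Int_\<H>\<close> only in this form: at
  most one extension of \<open>I\<close> is spoilt.\<close>

lemma insert_\<H>_unique:
  assumes "card I + 1 = k" "d \<notin> I" "d' \<notin> I" "insert d I \<in> \<H>" "insert d' I \<in> \<H>"
  shows "d = d'"
proof (rule ccontr)
  assume "d \<noteq> d'"
  then have "insert d I \<inter> insert d' I = I" "insert d I \<noteq> insert d' I"
    using assms by auto
  with card_Int_\<H>[of "insert d I" "insert d' I"] assms show False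
    by simp
qed

lemma insert_in_bases:
  assumes "card I + 1 = k" "D \<inter> I = {}" "2 \<le> card D"
  obtains d where "d \<in> D" "insert d I \<in> bases"
proof -
  obtain d d' where d: "d \<in> D" "d' \<in> D" "d \<noteq> d'"
    using assms(3) by (auto simp: numeral_2_eq_2 card_le_Suc_iff)
  have "d \<notin> I" "d' \<notin> I"
    using d assms(2) by auto
  then have "insert d I \<in> bases \<or> insert d' I \<in> bases"
    using assms(1) insert_\<H>_unique[of I d d'] d by (auto simp: bases_def)
  with d that show ?thesis
    by blast
qed

lemma indep_if_card_less:
  assumes "card I < k"
  shows "matroid_indep bases I"
proof -
  obtain J where J: "I \<subseteq> J" "card J = k - 1"
  proof -
    have "card I \<le> k - 1" "k - 1 \<le> CARD('n)"
      using assms k_le by linarith+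
    then show ?thesis
      using exists_subset_between[of I "k - 1" UNIV] that by auto
  qed
  have "2 \<le> card (- J)"
    using k_le by (simp add: Compl_eq_Diff_UNIV card_Diff_subset J)
  then obtain d where "insert d J \<in> bases"
    using insert_in_bases[of J "- J"] J two_le_k by auto
  then show ?thesis
    using J by (meson matroid_indep_def subset_insertI2)
qed

lemma bases_nonempty: "bases \<noteq> {}"
  using indep_if_card_less[of "{}"] two_le_k by (auto simp: matroid_indep_def)

lemma matroid_bases: "matroid UNIV bases"
proof -
  have "\<exists>b\<in>B - A. insert b (A - {a}) \<in> bases"
    if A: "A \<in> bases" and B: "B \<in> bases" and a: "a \<in> A - B" for A B a
  proof -
    have cards: "card A = k" "card B = k"
      using A B by (auto simp: bases_def)
    have cA: "card (A - {a}) + 1 = k"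
      using a cards two_le_k by simp
    have "card (B - A) = card (A - B)"
      using cards by (simp add: card_Diff_subset_Int Int_commute)
    moreover have "card (A - B) > 0"
      using a by (auto simp: card_gt_0_iff)
    \<comment> \<open>If \<open>A\<close> and \<open>B\<close> differ by a single swap, the exchange
      produces \<open>B\<close> itself. Otherwise there are two candidates, and \<open>\<H>\<close>
      excludes at most one.\<close>
    ultimately consider "card (B - A) = 1" "card (A - B) = 1" | "2 \<le> card (B - A)"
      by linarith
    then show ?thesis
    proof cases
      case 1
      then obtain b a' where "B - A = {b}" "A - B = {a'}"
        by (meson card_1_singletonE)
      with a have "insert b (A - {a}) = B" "b \<in> B - A"
        by auto
      with B show ?thesis
        by auto
    next
      case 2
      then show ?thesis
        using insert_in_bases[of "A - {a}" "B - A"] cA by blast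
    qed
  qed
  then show ?thesis
    using bases_nonempty by (auto simp: matroid_def)
qed

lemma matroid_rank_bases: "matroid_rank UNIV bases = k"
proof -
  obtain B where B: "B \<in> bases"
    using bases_nonempty by auto
  show ?thesis
    unfolding matroid_rank_def
  proof (intro Max_eqI)
    fix m assume "m \<in> card ` {I. I \<subseteq> UNIV \<and> matroid_indep bases I}"
    then obtain I B where "m = card I" "I \<subseteq> B" "B \<in> bases"
      by (auto simp: matroid_indep_def)
    then show "m \<le> k"
      by (auto simp: bases_def intro: card_mono)
  next
    show "k \<in> card ` {I. I \<subseteq> UNIV \<and> matroid_indep bases I}"
      using B by (intro image_eqI[of _ _ B]) (auto simp: matroid_indep_def bases_def)
  qed simp
qed

text \<open>Take a k-set \<open>I\<close> containing \<open>x\<close> and \<open>y\<close> and add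
  some \<open>d\<close> such that deleting \<open>x\<close> or \<open>y\<close> from the result
  \<open>C\<close> never gives a member of \<open>\<H>\<close>. Each of the two conditions excludes
  at most one \<open>d\<close>, and three are available. If some member of \<open>\<H>\<close> lies
  in \<open>C\<close>, it omits a third element and is a circuit through both; otherwise
  \<open>C\<close> is one.\<close>

lemma matroid_connected_bases: "matroid_connected UNIV bases"
  unfolding matroid_connected_def
proof (intro ballI impI)
  fix x y :: 'n assume "x \<noteq> y"
  then obtain I where I: "{x, y} \<subseteq> I" "card I = k"
    using exists_subset_between[of "{x, y}" k UNIV] two_le_k k_le by auto
  have cI: "card (I - {z}) + 1 = k" if "z \<in> I" for z
    using that I two_le_k by simp
  define bad where "bad z = {d. d \<notin> I \<and> insert d (I - {z}) \<in> \<H>}" for z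
  have bad: "card (bad z) \<le> 1" if "z \<in> I" for z
    using insert_\<H>_unique[OF cI[OF that]] by (auto simp: bad_def card_le_Suc0_iff_eq)
  have "card (bad x \<union> bad y) \<le> 2"
    using bad[of x] bad[of y] I card_Un_le[of "bad x" "bad y"] by auto
  moreover have "card (- I) \<ge> 3"
    using k_le by (simp add: Compl_eq_Diff_UNIV card_Diff_subset I)
  ultimately have "\<not> - I \<subseteq> bad x \<union> bad y"
    using card_mono[of "bad x \<union> bad y" "- I"] by auto
  then obtain d where d: "d \<notin> I" "d \<notin> bad x" "d \<notin> bad y"
    by auto
  define C where "C = insert d I"
  have C: "card C = k + 1" "x \<in> C" "y \<in> C"
    using d I by (auto simp: C_def)
  have C_dep: "\<not> matroid_indep bases C"
  proof
    assume "matroid_indep bases C"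
    then obtain B where "C \<subseteq> B" "card B = k"
      by (auto simp: matroid_indep_def bases_def)
    then show False
      using card_mono[of B C] C by simp
  qed
  have "C - {x} \<notin> \<H>" "C - {y} \<notin> \<H>"
    using d I by (auto simp: C_def bad_def insert_Diff_if split: if_splits)
  show "\<exists>C. matroid_circuit UNIV bases C \<and> x \<in> C \<and> y \<in> C"
  proof (cases "\<exists>H\<in>\<H>. H \<subseteq> C")
    case True
    then obtain H where H: "H \<in> \<H>" "H \<subseteq> C"
      by auto
    have "card (C - H) = 1"
      using H C by (simp add: card_Diff_subset card_\<H>)
    then obtain z where "C - H = {z}"
      by (meson card_1_singletonE)
    then have "H = C - {z}"
      using H by auto
    then have "x \<in> H" "y \<in> H"
      using \<open>C - {x} \<notin> \<H>\<close> \<open>C - {y} \<notin> \<H>\<close> C H by auto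
    moreover have "\<not> matroid_indep bases H"
    proof
      assume "matroid_indep bases H"
      then obtain B where "H \<subseteq> B" "B \<in> bases"
        by (auto simp: matroid_indep_def)
      moreover from this have "H = B"
        using card_\<H>[OF H(1)] by (intro card_subset_eq) (auto simp: bases_def)
      ultimately show False
        using H by (auto simp: bases_def)
    qed
    moreover have "matroid_indep bases D" if "D \<subset> H" for D
      using psubset_card_mono[OF _ that] card_\<H>[OF H(1)]
      by (intro indep_if_card_less) auto
    ultimately show ?thesis
      by (auto simp: matroid_circuit_def)
  next
    case False
    have "matroid_indep bases D" if "D \<subset> C" for D
    proof (cases "card D < k")
      case True
      then show ?thesis
        by (rule indep_if_card_less)
    next
      case False
      moreover have "card D < card C"
        using that by (intro psubset_card_mono) auto
      ultimately have "D \<in> bases"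
        using C that \<open>\<not> (\<exists>H\<in>\<H>. H \<subseteq> C)\<close> by (auto simp: bases_def)
      then show ?thesis
        by (auto simp: matroid_indep_def)
    qed
    with C C_dep show ?thesis
      by (auto simp: matroid_circuit_def)
  qed
qed

section \<open>Inequality description and dimension of the base polytope\<close>

lemma sum_pair_\<H>:
  fixes x :: "'n \<Rightarrow> 'b::ordered_ab_group_add"
  shows "sum x H + sum x H' = sum x UNIV - sum x (- (H \<union> H')) + sum x (H \<inter> H')"
proof -
  have "sum x UNIV = sum x (H \<union> H') + sum x (- (H \<union> H'))"
    using sum.subset_diff[of "H \<union> H'" UNIV x] by (simp add: Compl_eq_Diff_UNIV add.commute)
  then show ?thesis
    by (simp add: sum.union_inter[of H H' x, symmetric])
qed

text \<open>Among the vertices of the hypersimplex, the inequality for \<open>H\<close> removes only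
  the indicator of \<open>H\<close>. Equality with the base polytope is
  \<open>base_polytope_bases\<close>.\<close>

definition slack_polytope :: "(real ^ 'n) set" where
  "slack_polytope = {x. (\<forall>i. 0 \<le> x $ i \<and> x $ i \<le> 1) \<and> (\<Sum>i\<in>UNIV. x $ i) = real k \<and>
     (\<forall>H\<in>\<H>. (\<Sum>i\<in>H. x $ i) \<le> real k - 1)}"

lemma convex_slack_polytope: "convex slack_polytope"
proof (rule convexI)
  fix x y :: "real ^ 'n" and u v :: real
  assume *: "x \<in> slack_polytope" "y \<in> slack_polytope" "0 \<le> u" "0 \<le> v" "u + v = 1"
  have sum: "(\<Sum>i\<in>S. (u *\<^sub>R x + v *\<^sub>R y) $ i) = u * (\<Sum>i\<in>S. x $ i) + v * (\<Sum>i\<in>S. y $ i)" for S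
    by (simp add: sum.distrib sum_distrib_left)
  have "u * real k + v * real k = real k"
    using * by (metis distrib_right mult_1)
  with * show "u *\<^sub>R x + v *\<^sub>R y \<in> slack_polytope"
    unfolding slack_polytope_def mem_Collect_eq sum by (auto intro!: convex_bound_le)
qed

lemma compact_slack_polytope: "compact slack_polytope"
proof -
  have "closed slack_polytope"
    unfolding slack_polytope_def Ball_def
    by (intro closed_Collect_conj closed_Collect_all closed_Collect_imp closed_Collect_le
        closed_Collect_eq open_Collect_const continuous_intros)
  moreover have "slack_polytope \<subseteq> cbox 0 1"
    by (auto simp: slack_polytope_def mem_box_cart)
  ultimately show ?thesis
    by (metis bounded_cbox bounded_subset compact_eq_bounded_closed)
qed

text \<open>Adding the two equalities gives 2(k - 1) = k - x(outside) + x(H \<inter> H'). Since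
  x(outside) \<ge> 0 and x(H \<inter> H') is at most the size of the intersection, hence at most k -
  2, all these bounds are attained.\<close>

lemma tight_pair:
  assumes x: "x \<in> slack_polytope" and H: "H \<in> \<H>" "H' \<in> \<H>" "H \<noteq> H'"
    and tight: "(\<Sum>i\<in>H. x $ i) = real k - 1" "(\<Sum>i\<in>H'. x $ i) = real k - 1"
  shows "i \<in> H \<inter> H' \<Longrightarrow> x $ i = 1" and "i \<notin> H \<union> H' \<Longrightarrow> x $ i = 0"
proof -
  have x01: "0 \<le> x $ i" "x $ i \<le> 1" for i
    using x by (auto simp: slack_polytope_def)
  have le: "(\<Sum>i\<in>H \<inter> H'. x $ i) \<le> card (H \<inter> H')"
    using sum_bounded_above[of "H \<inter> H'" "($) x" 1] x01 by simp
  have ge: "0 \<le> (\<Sum>i\<in>- (H \<union> H'). x $ i)"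
    by (intro sum_nonneg) (simp add: x01)
  have card: "card (H \<inter> H') + 2 \<le> k"
    using H by (rule card_Int_\<H>)
  then have "real (card (H \<inter> H')) + 2 \<le> real k"
    by linarith
  moreover have "2 * (real k - 1) =
      real k - (\<Sum>i\<in>- (H \<union> H'). x $ i) + (\<Sum>i\<in>H \<inter> H'. x $ i)"
    using sum_pair_\<H>[of "($) x" H H'] tight x by (simp add: slack_polytope_def)
  ultimately have eq: "(\<Sum>i\<in>H \<inter> H'. 1 - x $ i) = 0" "(\<Sum>i\<in>- (H \<union> H'). x $ i) = 0"
    using le ge by (simp_all add: sum_subtractf)
  show "x $ i = 1" if "i \<in> H \<inter> H'"
    using eq(1) that x01 by (subst (asm) sum_nonneg_eq_0_iff) auto
  show "x $ i = 0" if "i \<notin> H \<union> H'"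
    using eq(2) that x01 by (subst (asm) sum_nonneg_eq_0_iff) auto
qed

text \<open>Moving by a small multiple of e_a - e_b in either direction preserves the total and
  every tight sum, since a tight \<open>H\<close> contains both or neither of \<open>a\<close> and
  \<open>b\<close>. Hence \<open>x\<close> is a midpoint of two other points of the
  polytope.\<close>

lemma not_extreme_if_exchange:
  assumes x: "x \<in> slack_polytope" and ab: "a \<noteq> b"
    and frac: "0 < x $ a" "x $ a < 1" "0 < x $ b" "x $ b < 1"
    and tight: "\<And>H. \<lbrakk>H \<in> \<H>; (\<Sum>i\<in>H. x $ i) = real k - 1\<rbrakk> \<Longrightarrow> a \<in> H \<longleftrightarrow> b \<in> H"
  shows "\<not> x extreme_point_of slack_polytope"
proof -
  \<comment> \<open>The positive slacks of all constraints that the move could violate; their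
    minimum is a safe step length.\<close>
  define T where "T = {x $ a, 1 - x $ a, x $ b, 1 - x $ b} \<union>
    (\<lambda>H. real k - 1 - (\<Sum>i\<in>H. x $ i)) ` {H \<in> \<H>. (\<Sum>i\<in>H. x $ i) < real k - 1}"
  define \<epsilon> where "\<epsilon> = Min T"
  have T: "finite T" "T \<noteq> {}" "\<And>r. r \<in> T \<Longrightarrow> 0 < r"
    using frac by (auto simp: T_def)
  then have \<epsilon>: "0 < \<epsilon>" "\<And>r. r \<in> T \<Longrightarrow> \<epsilon> \<le> r"
    by (auto simp: \<epsilon>_def)
  define d :: "real ^ 'n" where "d = axis a 1 - axis b 1"
  have d: "d $ i = of_bool (i = a) - of_bool (i = b)" for i
    by (auto simp: d_def axis_def)
  have sum_d: "(\<Sum>i\<in>S. (x + c *\<^sub>R d) $ i) =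
      (\<Sum>i\<in>S. x $ i) + c * (of_bool (a \<in> S) - of_bool (b \<in> S))" for S c
    by (simp add: d sum.distrib sum_distrib_left[symmetric] sum_subtractf of_bool_def sum.delta)
  have mem: "x + c *\<^sub>R d \<in> slack_polytope" if c: "\<bar>c\<bar> = \<epsilon>" for c
    unfolding slack_polytope_def mem_Collect_eq sum_d
  proof (intro conjI allI ballI)
    have "\<bar>c\<bar> \<le> x $ a" "\<bar>c\<bar> \<le> 1 - x $ a" "\<bar>c\<bar> \<le> x $ b" "\<bar>c\<bar> \<le> 1 - x $ b"
      unfolding c by (auto intro!: \<epsilon> simp: T_def)
    then show "0 \<le> (x + c *\<^sub>R d) $ i" "(x + c *\<^sub>R d) $ i \<le> 1" for i
      using x ab by (auto simp: d slack_polytope_def)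
    fix H assume H: "H \<in> \<H>"
    show "(\<Sum>i\<in>H. x $ i) + c * (of_bool (a \<in> H) - of_bool (b \<in> H)) \<le> real k - 1"
    proof (cases "(\<Sum>i\<in>H. x $ i) = real k - 1")
      case True
      with tight[OF H] show ?thesis
        by simp
    next
      case False
      then have "(\<Sum>i\<in>H. x $ i) < real k - 1"
        using x H by (force simp: slack_polytope_def)
      then have "\<bar>c\<bar> \<le> real k - 1 - (\<Sum>i\<in>H. x $ i)"
        unfolding c using H by (intro \<epsilon>) (auto simp: T_def)
      then show ?thesis
        by (auto simp: of_bool_def)
    qed
  qed (use x in \<open>auto simp: slack_polytope_def\<close>)
  have "(x - \<epsilon> *\<^sub>R d) $ a \<noteq> (x + \<epsilon> *\<^sub>R d) $ a"
    using \<epsilon>(1) ab by (simp add: d)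
  then have "x - \<epsilon> *\<^sub>R d \<noteq> x + \<epsilon> *\<^sub>R d"
    by metis
  then have "midpoint (x - \<epsilon> *\<^sub>R d) (x + \<epsilon> *\<^sub>R d) \<in> open_segment (x - \<epsilon> *\<^sub>R d) (x + \<epsilon> *\<^sub>R d)"
    by simp
  moreover have "midpoint (x - \<epsilon> *\<^sub>R d) (x + \<epsilon> *\<^sub>R d) = x"
    by (simp add: midpoint_def scaleR_2[symmetric])
  ultimately show ?thesis
    using mem[of \<epsilon>] mem[of "- \<epsilon>"] \<epsilon>(1) by (auto simp: extreme_point_of_def)
qed

text \<open>A single fractional coordinate in \<open>S\<close> would make the sum over
  \<open>S\<close> non-integral.\<close>

lemma exists_second_fractional:
  fixes x :: "real ^ 'n"
  assumes "\<forall>i. 0 \<le> x $ i \<and> x $ i \<le> 1" "a \<in> S" "0 < x $ a" "x $ a < 1" "(\<Sum>i\<in>S. x $ i) \<in> \<int>"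
  obtains b where "b \<in> S" "b \<noteq> a" "0 < x $ b" "x $ b < 1"
proof -
  have "\<exists>b\<in>S - {a}. x $ b \<noteq> 0 \<and> x $ b \<noteq> 1"
  proof (rule ccontr)
    assume "\<not> ?thesis"
    then have "(\<Sum>i\<in>S - {a}. x $ i) \<in> \<int>"
      by (intro Ints_sum) force
    then have "(\<Sum>i\<in>S. x $ i) - (\<Sum>i\<in>S - {a}. x $ i) \<in> \<int>"
      using assms by auto
    then have "x $ a \<in> \<int>"
      using assms(2) by (simp add: sum.remove[of S a])
    then show False
      using assms(3,4) by (auto elim!: Ints_cases)
  qed
  then show ?thesis
    using that assms(1) by (metis DiffE insertI1 order_less_le)
qed

text \<open>If \<open>H\<close> is tight and \<open>i\<close> is fractional, there is a second fractional coordinate on the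
  same side of \<open>H\<close>, and by \<open>tight_pair\<close> no other tight constraint can separate the two.\<close>

lemma extreme_point_integral:
  assumes "x extreme_point_of slack_polytope"
  shows "x $ i = 0 \<or> x $ i = 1"
proof (rule ccontr)
  assume i: "\<not> ?thesis"
  have x: "x \<in> slack_polytope"
    using assms by (simp add: extreme_point_of_def)
  then have x01: "\<forall>i. 0 \<le> x $ i \<and> x $ i \<le> 1"
    by (simp add: slack_polytope_def)
  have a: "0 < x $ i" "x $ i < 1"
    using i x01 by (auto simp: order_less_le)
  show False
  proof (cases "\<exists>H\<in>\<H>. (\<Sum>i\<in>H. x $ i) = real k - 1")
    case False
    obtain b where "b \<noteq> i" "0 < x $ b" "x $ b < 1"
      using exists_second_fractional[OF x01 _ a, of UNIV] x by (auto simp: slack_polytope_def)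
    then show False
      using not_extreme_if_exchange[OF x, of i b] a False assms by auto
  next
    case True
    then obtain H where H: "H \<in> \<H>" "(\<Sum>i\<in>H. x $ i) = real k - 1"
      by auto
    define S where "S = (if i \<in> H then H else - H)"
    have "(\<Sum>i\<in>- H. x $ i) = (\<Sum>i\<in>UNIV. x $ i) - (\<Sum>i\<in>H. x $ i)"
      using sum.subset_diff[of H UNIV "($) x"] by (simp add: Compl_eq_Diff_UNIV)
    then have "(\<Sum>i\<in>S. x $ i) \<in> \<int>"
      using H x by (auto simp: S_def slack_polytope_def)
    moreover have "i \<in> S"
      by (simp add: S_def)
    ultimately obtain b where b: "b \<in> S" "b \<noteq> i" "0 < x $ b" "x $ b < 1"
      using exists_second_fractional[OF x01 _ a] by blast
    have "i \<in> H' \<longleftrightarrow> b \<in> H'" if H': "H' \<in> \<H>" "(\<Sum>i\<in>H'. x $ i) = real k - 1" for H'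
    proof (cases "H' = H")
      case True
      then show ?thesis
        using b by (auto simp: S_def split: if_splits)
    next
      case False
      note * = tight_pair[OF x H(1) H'(1) False[symmetric] H(2) H'(2)]
      show ?thesis
        using *[of i] *[of b] a b by (auto simp: S_def split: if_splits)
    qed
    then show False
      using not_extreme_if_exchange[OF x, of i b] a b assms by auto
  qed
qed

text \<open>A base meets each \<open>H\<close> in fewer than \<open>k\<close> elements, which gives
  one inclusion. For the other, the compact convex \<open>slack_polytope\<close> is the hull of its
  extreme points; these are 0/1 vectors, hence indicators of k-sets, and the inequality for
  \<open>H\<close> rules out the indicator of \<open>H\<close>.\<close>

lemma base_polytope_bases: "base_polytope bases = slack_polytope"
proof
  have e: "(\<Sum>i\<in>B. axis i 1 :: real ^ 'n) $ j = of_bool (j \<in> B)" for B j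
    by (simp add: axis_def of_bool_def sum.delta)
  show "base_polytope bases \<subseteq> slack_polytope"
    unfolding base_polytope_def
  proof (rule hull_minimal)
    show "(\<lambda>B. \<Sum>i\<in>B. axis i 1) ` bases \<subseteq> slack_polytope"
    proof
      fix x :: "real ^ 'n" assume "x \<in> (\<lambda>B. \<Sum>i\<in>B. axis i 1) ` bases"
      then obtain B where B: "B \<in> bases" and x: "x = (\<Sum>i\<in>B. axis i 1)"
        by auto
      have sum_x: "(\<Sum>i\<in>S. x $ i) = card (S \<inter> B)" for S
        unfolding x e by (simp add: of_bool_def sum.If_cases)
      have "card (H \<inter> B) + 1 \<le> k" if "H \<in> \<H>" for H
      proof -
        have "card H = card B" "H \<noteq> B"
          using that B card_\<H> by (auto simp: bases_def)
        then have "H \<inter> B \<subset> B"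
          using card_subset_eq[of H B] by auto
        then have "card (H \<inter> B) < card B"
          by (intro psubset_card_mono) auto
        then show ?thesis
          using B by (auto simp: bases_def)
      qed
      then have "real (card (H \<inter> B)) \<le> real k - 1" if "H \<in> \<H>" for H
        using that by fastforce
      then show "x \<in> slack_polytope"
        using B unfolding slack_polytope_def mem_Collect_eq sum_x
        by (auto simp: x e bases_def simp del: sum_component)
    qed
  qed (rule convex_slack_polytope)
  have "x \<in> (\<lambda>B. \<Sum>i\<in>B. axis i 1) ` bases" if x: "x extreme_point_of slack_polytope" for x
  proof -
    have Q: "x \<in> slack_polytope"
      using x by (simp add: extreme_point_of_def)
    define B where "B = {i. x $ i = 1}"
    have xB: "x $ i = of_bool (i \<in> B)" for i
      using extreme_point_integral[OF x, of i] by (auto simp: B_def)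
    have sum_x: "(\<Sum>i\<in>S. x $ i) = card (S \<inter> B)" for S
      unfolding xB by (simp add: of_bool_def sum.If_cases)
    have "card B = k" "B \<notin> \<H>"
      using Q sum_x[of UNIV] sum_x[of B] by (force simp: slack_polytope_def)+
    then have "B \<in> bases"
      by (auto simp: bases_def)
    moreover have "x = (\<Sum>i\<in>B. axis i 1)"
      by (simp add: vec_eq_iff e xB del: sum_component)
    ultimately show ?thesis
      by blast
  qed
  then have "{x. x extreme_point_of slack_polytope} \<subseteq> (\<lambda>B. \<Sum>i\<in>B. axis i 1) ` bases"
    by blast
  then show "slack_polytope \<subseteq> base_polytope bases"
    unfolding base_polytope_def
    using Krein_Milman_Minkowski[OF compact_slack_polytope convex_slack_polytope] hull_mono
    by metis
qed

text \<open>The constant vector \<open>c\<close> satisfies all inequalities strictly, so the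
  polytope contains a nonempty relatively open piece of the hyperplane \<open>A\<close>.\<close>

lemma aff_dim_base_polytope: "aff_dim (base_polytope bases) = int (CARD('n)) - 1"
proof -
  define c :: "real ^ 'n" where "c = (\<chi> i. real k / CARD('n))"
  define A :: "(real ^ 'n) set" where "A = {x. 1 \<bullet> x = real k}"
  define T where "T = {x :: real ^ 'n. (\<forall>i. 0 < x $ i \<and> x $ i < 1) \<and>
    (\<forall>H\<in>\<H>. (\<Sum>i\<in>H. x $ i) < real k - 1)}"
  have A_iff: "x \<in> A \<longleftrightarrow> (\<Sum>i\<in>UNIV. x $ i) = real k" for x
    by (simp add: A_def inner_vec_def)
  have "T = (\<Inter>i. {x. 0 < x $ i} \<inter> {x. x $ i < 1}) \<inter> (\<Inter>H\<in>\<H>. {x. (\<Sum>i\<in>H. x $ i) < real k - 1})"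
    by (auto simp: T_def)
  then have "open T"
    by (auto intro!: open_Int open_INT open_Collect_less continuous_intros)
  \<comment> \<open>Strictness at \<open>c\<close> for \<open>H\<close> means k^2/n < k - 1. The
    product on the right is k^2 + 2k - 3, which exceeds k^2 once k \<ge> 2.\<close>
  have "k * k < (k - 1) * (k + 3)"
    using two_le_k by (auto simp: le_iff_add algebra_simps)
  also have "\<dots> \<le> (k - 1) * CARD('n)"
    using k_le by (intro mult_left_mono) auto
  finally have "real k * real k < (real k - 1) * CARD('n)"
    using two_le_k by (metis (no_types, opaque_lifting) of_nat_1 of_nat_diff of_nat_less_iff
        of_nat_mult one_le_numeral order_trans)
  then have "c \<in> A \<inter> T"
    using two_le_k k_le card_\<H> by (auto simp: A_iff T_def c_def field_simps)
  then have "affine hull (A \<inter> T) = A"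
    using \<open>open T\<close> affine_hull_affine_Int_open[of A T] affine_hull_eq[of A]
    by (metis A_def affine_hyperplane empty_iff)
  moreover have "aff_dim A = int (CARD('n)) - 1"
    unfolding A_def by (subst aff_dim_hyperplane) (auto simp: vec_eq_iff)
  moreover have "A \<inter> T \<subseteq> base_polytope bases" "base_polytope bases \<subseteq> A"
    by (auto simp: base_polytope_bases slack_polytope_def A_iff T_def order_less_imp_le)
  ultimately show ?thesis
    by (metis aff_dim_affine_hull aff_dim_subset order_antisym)
qed

section \<open>Lattice points in the dilations\<close>

lemma scaled_base_polytope:
  "(*\<^sub>R) (real t) ` base_polytope bases =
     {x. (\<forall>i. 0 \<le> x $ i \<and> x $ i \<le> real t) \<and> (\<Sum>i\<in>UNIV. x $ i) = real (k * t) \<and>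
       (\<forall>H\<in>\<H>. (\<Sum>i\<in>H. x $ i) \<le> real ((k - 1) * t))}" (is "_ = ?R")
\<comment> \<open>Rescaling by 1/t needs t > 0. For t = 0 both sides are the origin, the left one
  because bases exist.\<close>
proof (cases "t = 0")
  case True
  have "base_polytope bases \<noteq> {}"
    using bases_nonempty by (simp add: base_polytope_def)
  then have "(*\<^sub>R) (real t) ` base_polytope bases = {0}"
    using True by auto
  also have "\<dots> = ?R"
    using True by (auto simp: vec_eq_iff) (meson order_antisym)
  finally show ?thesis .
next
  case False
  have iff: "x /\<^sub>R real t \<in> slack_polytope \<longleftrightarrow> x \<in> ?R" for x
    using False two_le_k
    by (simp add: slack_polytope_def sum_divide_distrib[symmetric] field_simps of_nat_diff)
  show ?thesis
  proof (intro set_eqI iffI)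
    fix x assume "x \<in> (*\<^sub>R) (real t) ` base_polytope bases"
    then obtain z where "z \<in> slack_polytope" "x = real t *\<^sub>R z"
      by (auto simp: base_polytope_bases)
    then show "x \<in> ?R"
      using iff[of x] False by simp
  next
    fix x assume "x \<in> ?R"
    then have "x /\<^sub>R real t \<in> base_polytope bases"
      using iff[of x] by (simp add: base_polytope_bases)
    moreover have "x = real t *\<^sub>R (x /\<^sub>R real t)"
      using False by simp
    ultimately show "x \<in> (*\<^sub>R) (real t) ` base_polytope bases"
      by (rule image_eqI[rotated])
  qed
qed

lemma card_lattice_points:
  "card ((*\<^sub>R) (real t) ` base_polytope bases \<inter> lattice_points) =
     card {y :: 'n \<Rightarrow> nat. (\<forall>i. y i \<le> t) \<and> sum y UNIV = k * t \<and> (\<forall>H\<in>\<H>. sum y H \<le> (k - 1) * t)}"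
    (is "card ?L = card ?Y")
proof (rule bij_betw_same_card)
  have sum: "(\<Sum>i\<in>S. real (y i)) = real (sum y S)" for S and y :: "'n \<Rightarrow> nat"
    by simp
  have nat: "real (nat \<lfloor>x $ i\<rfloor>) = x $ i" if "x \<in> ?L" for x :: "real ^ 'n" and i
    using that by (auto simp: scaled_base_polytope lattice_points_def elim!: Ints_cases[of "x $ i"])
  have mem: "(\<lambda>i. nat \<lfloor>x $ i\<rfloor>) \<in> ?Y" if x: "x \<in> ?L" for x
  proof -
    define y where "y i = nat \<lfloor>x $ i\<rfloor>" for i
    have y: "x $ i = real (y i)" for i
      using nat[OF x] by (simp add: y_def)
    then have sum_x: "(\<Sum>i\<in>S. x $ i) = real (sum y S)" for S
      by simp
    have "y \<in> ?Y"
      using x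
      by (simp only: sum_x scaled_base_polytope of_nat_le_iff of_nat_eq_iff Int_iff mem_Collect_eq) (simp add: y)
    then show ?thesis
      by (simp add: y_def[abs_def])
  qed
  have mem': "(\<chi> i. real (y i)) \<in> ?L" if "y \<in> ?Y" for y
    unfolding scaled_base_polytope lattice_points_def Int_iff mem_Collect_eq vec_lambda_beta sum
      of_nat_le_iff of_nat_eq_iff using that by simp
  show "bij_betw (\<lambda>x i. nat \<lfloor>x $ i\<rfloor>) ?L ?Y"
    by (rule bij_betw_byWitness[where f' = "\<lambda>y. \<chi> i. real (y i)"])
      (use mem mem' nat in \<open>auto simp: vec_eq_iff\<close>)
qed

text \<open>Reflecting the coordinates in \<open>H\<close> by \<open>y \<mapsto> t - y\<close> turns a corner into pairs of weak
  compositions, on \<open>H\<close> and on its complement, of a common number \<open>s < t\<close>; the upper bounds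
  \<open>y i \<le> t\<close> then hold automatically.\<close>

lemma card_corner_points:
  assumes "H \<in> \<H>"
  shows "card {y :: 'n \<Rightarrow> nat. (\<forall>i. y i \<le> t) \<and> sum y UNIV = k * t \<and> (k - 1) * t < sum y H} =
    (\<Sum>s<t. ((s + k - 1) choose (k - 1)) * ((s + CARD('n) - k - 1) choose (CARD('n) - k - 1)))"
    (is "card ?Y = _")
proof -
  define W where "W A s = {y :: 'n \<Rightarrow> nat. y \<in> extensional A \<and> sum y A = s}" for A s
  have card_W: "card (W H s) = (s + k - 1) choose (k - 1)"
    "card (W (- H) s) = (s + CARD('n) - k - 1) choose (CARD('n) - k - 1)" for s
    unfolding W_def
    using card_weak_compositions[of H "k - 1" s] card_\<H>[OF assms] two_le_k k_le
      card_weak_compositions[of "- H" "CARD('n) - k - 1" s]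
    by (simp_all add: Compl_eq_Diff_UNIV card_Diff_subset)
  have finite_W: "finite (W A s)" for A s
  proof (rule finite_subset)
    show "W A s \<subseteq> A \<rightarrow>\<^sub>E {..s}"
      by (auto simp: W_def PiE_def intro: member_le_sum)
  qed (auto intro: finite_PiE)
  have split: "sum y UNIV = sum y H + sum y (- H)" for y :: "'n \<Rightarrow> nat"
    using sum.subset_diff[of H UNIV y] by (simp add: Compl_eq_Diff_UNIV add.commute)
  have kt: "k * t = (k - 1) * t + t"
    using two_le_k by (simp add: diff_mult_distrib)
  have compl_sum: "(\<Sum>i\<in>H. t - y i) = k * t - sum y H" if "\<forall>i\<in>H. y i \<le> t" for y :: "'n \<Rightarrow> nat"
    using that card_\<H>[OF assms] by (subst sum_subtractf_nat) auto
  define f where "f x = (k * t - sum x H, restrict (\<lambda>i. t - x i) H, restrict x (- H))"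
    for x :: "'n \<Rightarrow> nat"
  define g where "g = (\<lambda>(s :: nat, y, z). \<lambda>i :: 'n. if i \<in> H then t - y i else z i :: nat)"
  let ?T = "SIGMA s:{..<t}. W H s \<times> W (- H) s"
  have "bij_betw f ?Y ?T"
  proof (rule bij_betw_byWitness[where f' = g])
    show "\<forall>x\<in>?Y. g (f x) = x"
      by (auto simp: f_def g_def fun_eq_iff)
    show "f ` ?Y \<subseteq> ?T"
    proof
      fix w assume "w \<in> f ` ?Y"
      then obtain x where x: "x \<in> ?Y" "w = f x"
        by auto
      then show "w \<in> ?T"
        using compl_sum[of x] split[of x] kt by (auto simp: f_def W_def)
    qed
    have small: "y i \<le> t" if "y \<in> W A s" "s < t" "i \<in> A" for y A s i
      using that member_le_sum[of i A y] by (auto simp: W_def)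
    have sums: "sum (g (s, y, z)) H = k * t - s" "sum (g (s, y, z)) (- H) = s"
      if "s < t" "y \<in> W H s" "z \<in> W (- H) s" for s y z
      using that compl_sum[of y] small[of y H s]
      by (auto simp: g_def W_def intro!: sum.cong)
    have tk: "t \<le> k * t"
      using two_le_k by simp
    show "\<forall>w\<in>?T. f (g w) = w"
    proof
      fix w assume "w \<in> ?T"
      then obtain s y z where w: "w = (s, y, z)" "s < t" "y \<in> W H s" "z \<in> W (- H) s"
        by auto
      have "restrict (\<lambda>i. t - g w i) H = y" "restrict (g w) (- H) = z"
        using w small[of y H s] by (auto simp: g_def W_def fun_eq_iff extensional_def)
      moreover have "k * t - (k * t - s) = s"
        using tk w(2) by linarith
      ultimately show "f (g w) = w"
        using sums[OF w(2-4)] by (simp add: f_def w(1))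
    qed
    show "g ` ?T \<subseteq> ?Y"
    proof
      fix x assume "x \<in> g ` ?T"
      then obtain s y z where w: "x = g (s, y, z)" "s < t" "y \<in> W H s" "z \<in> W (- H) s"
        by auto
      have "x i \<le> t" for i
        using w small[of z "- H" s i] by (auto simp: g_def)
      moreover have "sum x UNIV = k * t" "(k - 1) * t < sum x H"
        using sums[OF w(2-4)] split[of x] w(1,2) tk kt by auto
      ultimately show "x \<in> ?Y"
        by simp
    qed
  qed
  then have "card ?Y = card ?T"
    by (rule bij_betw_same_card)
  also have "\<dots> = (\<Sum>s<t. card (W H s) * card (W (- H) s))"
    by (simp add: finite_W card_cartesian_product)
  finally show ?thesis
    by (simp add: card_W)
qed

text \<open>The points of the dilated hypersimplex split into those of the base polytope and one
  corner for each \<open>H\<close>. The additive form avoids subtracting the corners in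
  \<open>nat\<close>.\<close>

lemma card_lattice_points_eq:
  "card ((*\<^sub>R) (real t) ` base_polytope bases \<inter> lattice_points) + card \<H> *
     (\<Sum>s<t. ((s + k - 1) choose (k - 1)) * ((s + CARD('n) - k - 1) choose (CARD('n) - k - 1))) =
   card {y :: 'n \<Rightarrow> nat. (\<forall>i. y i \<le> t) \<and> sum y UNIV = k * t}"
proof -
  let ?Y = "{y :: 'n \<Rightarrow> nat. (\<forall>i. y i \<le> t) \<and> sum y UNIV = k * t}"
  let ?L = "{y :: 'n \<Rightarrow> nat. (\<forall>i. y i \<le> t) \<and> sum y UNIV = k * t \<and> (\<forall>H\<in>\<H>. sum y H \<le> (k - 1) * t)}"
  let ?C = "\<lambda>H. {y :: 'n \<Rightarrow> nat. (\<forall>i. y i \<le> t) \<and> sum y UNIV = k * t \<and> (k - 1) * t < sum y H}"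
  have fin: "finite ?Y"
  proof (rule finite_subset)
    show "?Y \<subseteq> UNIV \<rightarrow>\<^sub>E {..t}"
      by auto
  qed (auto intro: finite_PiE)
  \<comment> \<open>In a common point y(H) + y(H') would exceed 2(k - 1)t, but the union contributes
    at most kt and the intersection at most (k - 2)t.\<close>
  have disj: "?C H \<inter> ?C H' = {}" if H: "H \<in> \<H>" "H' \<in> \<H>" "H \<noteq> H'" for H H'
  proof (rule ccontr)
    assume "?C H \<inter> ?C H' \<noteq> {}"
    then obtain y where y: "\<forall>i. y i \<le> t" "sum y UNIV = k * t"
      "(k - 1) * t < sum y H" "(k - 1) * t < sum y H'"
      by auto
    have "sum y (H \<union> H') \<le> sum y UNIV"
      by (intro sum_mono2) auto
    moreover have "sum y (H \<inter> H') \<le> card (H \<inter> H') * t"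
      using sum_bounded_above[of "H \<inter> H'" y t] y by simp
    moreover have "\<dots> \<le> (k - 2) * t"
      using card_Int_\<H>[OF H] by (intro mult_le_mono1) auto
    moreover have "sum y (H \<union> H') + sum y (H \<inter> H') = sum y H + sum y H'"
      by (rule sum.union_inter) auto
    moreover have "k * t + (k - 2) * t = 2 * ((k - 1) * t)"
      using two_le_k by (auto simp: le_iff_add algebra_simps)
    ultimately show False
      using y by linarith
  qed
  have "?Y = ?L \<union> (\<Union>H\<in>\<H>. ?C H)"
    by (auto simp: not_le)
  then have "card ?Y = card (?L \<union> (\<Union>H\<in>\<H>. ?C H))"
    by simp
  also have "\<dots> = card ?L + card (\<Union>H\<in>\<H>. ?C H)"
    by (rule card_Un_disjoint) (auto intro!: finite_subset[OF _ fin] simp: not_le[symmetric])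
  also have "card (\<Union>H\<in>\<H>. ?C H) = (\<Sum>H\<in>\<H>. card (?C H))"
    by (intro card_UN_disjoint) (use disj in \<open>auto intro!: finite_subset[OF _ fin]\<close>)
  also have "\<dots> = card \<H> *
      (\<Sum>s<t. ((s + k - 1) choose (k - 1)) * ((s + CARD('n) - k - 1) choose (CARD('n) - k - 1)))"
    by (subst sum.cong[OF refl card_corner_points]) simp_all
  finally show ?thesis
    by (simp only: card_lattice_points)
qed

end

section \<open>The zero-sum code\<close>

text \<open>Both polynomials are scaled by \<open>19!\<close>, which makes all coefficients integers. The coefficients
  of \<open>corner_poly\<close> come from solving the difference equation \<open>pcompose_corner_poly\<close>, where
  \<open>831402 = 19! / (8! 10!)\<close>.\<close>

definition corner_poly :: "real poly" where
  "corner_poly =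
    [:0, 146313216000, 1547381458022400, 8324310761395200, 20086214397080832, 28954502973519552,
     28019700068437792, 19379692303088832, 9949463008028544, 3883107888486684,
     1169123137896714, 273669181318494, 49898251247416, 7058062184976, 766162993596,
     62569651716, 3716921208, 151510788, 3787498, 43758:]"

text \<open>Term \<open>j\<close> is 19! times the binomial in
  \<open>card_hypersimplex_points\<close> for k = 9, n = 20: the rising product from (9 - j)t + 1 -
  j to (9 - j)t + 19 - j.\<close>

definition hypersimplex_poly :: "real poly" where
  "hypersimplex_poly =
    (\<Sum>j<9. smult ((- 1) ^ j * real (20 choose j)) (pochhammer [:1 - real j, 9 - real j:] 19))"

section \<open>Explicit polynomial identities for the two counts\<close>

lemma pochhammer_linear_poly:
  "pochhammer [:a, b:] n = (\<Prod>i<n. [:a + of_nat i, b:])" for a b :: "'a::comm_semiring_1"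
  by (simp add: pochhammer_prod of_nat_poly atLeast0LessThan)

lemma poly_pochhammer_linear:
  "poly (pochhammer [:a, b:] n) x = pochhammer (a + x * b) n" for a b x :: "'a::comm_semiring_1"
  by (simp add: pochhammer_linear_poly poly_prod pochhammer_prod atLeast0LessThan algebra_simps)

text \<open>The added term takes the value 19! C(t+8,8) C(t+10,10) at \<open>t\<close>. With
  constant term 0, the polynomial therefore telescopes to the corner count.\<close>

lemma pcompose_corner_poly:
  "pcompose corner_poly [:1, 1:] =
     corner_poly + smult 831402 (pochhammer [:1, 1:] 8 * pochhammer [:1, 1:] 10)"
  by (simp add: corner_poly_def pcompose_pCons pochhammer_linear_poly lessThan_Suc numeral_eq_Suc)

text \<open>Checked by full expansion. The constant term is 19!, so it becomes 1 after
  normalization; the coefficients of degrees 2 and 3 are negative.\<close>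

lemma hypersimplex_minus_corner_poly:
  "hypersimplex_poly - smult 8398 corner_poly =
    [:121645100408832000, 1613662041367756800, -1120329305412756480, -11386649731046487552,
     41670842892843299904, 335651850678616068384, 1020848614600533289504,
     2029123771053245124912, 3029233251006661904868, 3590795887951252808178,
     3457323617676774465048, 2722330732634466901506, 1749482258814852490552,
     909885010177943888292, 377312857121481669312, 121865195401405703460, 29549299671807788676,
     5060433229574414346, 545698137074808616, 27862280199613674:]"
proof -
  have choose: "(20::nat) choose 2 = 190" "(20::nat) choose 3 = 1140" "(20::nat) choose 4 = 4845"
    "(20::nat) choose 5 = 15504" "(20::nat) choose 6 = 38760" "(20::nat) choose 7 = 77520"
    "(20::nat) choose 8 = 125970"
    by (simp_all add: binomial_fact' fact_numeral)
  have "hypersimplex_poly = pochhammer [:1, 9:] 19 - smult 20 (pochhammer [:0, 8:] 19) +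
      smult 190 (pochhammer [:-1, 7:] 19) - smult 1140 (pochhammer [:-2, 6:] 19) +
      smult 4845 (pochhammer [:-3, 5:] 19) - smult 15504 (pochhammer [:-4, 4:] 19) +
      smult 38760 (pochhammer [:-5, 3:] 19) - smult 77520 (pochhammer [:-6, 2:] 19) +
      smult 125970 (pochhammer [:-7, 1:] 19)"
    by (simp add: hypersimplex_poly_def lessThan_nat_numeral choose)
  show ?thesis
    unfolding \<open>hypersimplex_poly = _\<close>
    by (simp add: corner_poly_def pochhammer_linear_poly lessThan_Suc numeral_eq_Suc)
qed

text \<open>The rising product runs over m - d + 1, ..., m. For m < d it contains the factor 0,
  matching the vanishing binomial, so the polynomials are right for small \<open>t\<close>
  too.\<close>

lemma fact_mult_binomial: "fact d * real (m choose d) = pochhammer (real m - real d + 1) d"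
  by (simp add: binomial_gbinomial gbinomial_pochhammer')

lemma poly_corner_poly:
  "poly corner_poly (real t) = fact 19 * (\<Sum>s<t. real ((s + 8) choose 8) * real ((s + 10) choose 10))"
proof (induction t)
  case 0
  then show ?case
    by (simp add: corner_poly_def)
next
  case (Suc t)
  have "(fact 19 :: real) = 831402 * fact 8 * fact 10"
    by (simp add: fact_numeral)
  then have "fact 19 * (real ((t + 8) choose 8) * real ((t + 10) choose 10)) =
      831402 * (fact 8 * real ((t + 8) choose 8)) * (fact 10 * real ((t + 10) choose 10))"
    by simp
  also have "\<dots> = 831402 * (pochhammer (1 + real t) 8 * pochhammer (1 + real t) 10)"
    unfolding fact_mult_binomial by (simp add: add.commute)
  also have "\<dots> = poly (smult 831402 (pochhammer [:1, 1:] 8 * pochhammer [:1, 1:] 10)) (real t)"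
    by (simp add: poly_pochhammer_linear)
  also have "\<dots> = poly corner_poly (real (Suc t)) - poly corner_poly (real t)"
    using arg_cong[OF pcompose_corner_poly, of "\<lambda>p. poly p (real t)"] by (simp add: poly_pcompose)
  finally show ?case
    using Suc by (simp add: distrib_left)
qed

lemma poly_hypersimplex_poly:
  "poly hypersimplex_poly (real t) =
     fact 19 * real (card {y :: 20 \<Rightarrow> nat. (\<forall>i. y i \<le> t) \<and> sum y UNIV = 9 * t})"
proof -
  have "fact 19 * real ((9 - j) * t + 20 - 1 - j choose 19) =
      poly (pochhammer [:1 - real j, 9 - real j:] 19) (real t)" if "j < 9" for j
  proof -
    \<comment> \<open>For j < 9 no subtraction truncates, so the expression carries over to the
      reals.\<close>
    have "(9 - j) * t + 20 - 1 - j = (9 - j) * t + (19 - j)"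
      using that by simp
    then have eq: "real ((9 - j) * t + 20 - 1 - j) = (9 - real j) * real t + (19 - real j)"
      using that by (simp add: of_nat_diff)
    show ?thesis
      unfolding fact_mult_binomial poly_pochhammer_linear eq by (simp add: algebra_simps)
  qed
  then have "poly hypersimplex_poly (real t) =
      (\<Sum>j<9. (- 1) ^ j * real (20 choose j) * (fact 19 * real ((9 - j) * t + 20 - 1 - j choose 19)))"
    unfolding hypersimplex_poly_def poly_sum poly_smult by (intro sum.cong refl) simp
  also have "\<dots> =
      fact 19 * (\<Sum>j<9. (- 1) ^ j * real (20 choose j) * real ((9 - j) * t + 20 - 1 - j choose 19))"
    by (simp only: sum_distrib_left mult.left_commute)
  also have "(\<Sum>j<9. (- 1) ^ j * real (20 choose j) * real ((9 - j) * t + 20 - 1 - j choose 19)) =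
      real (card {y :: 20 \<Rightarrow> nat. (\<forall>i. y i \<le> t) \<and> sum y UNIV = 9 * t})"
  proof -
    have "CARD(20) = 20" "(20 :: nat) - 1 = 19" "(0 :: nat) < 9" "9 \<le> (20 :: nat)"
      by simp_all
    then show ?thesis
      using card_hypersimplex_points[where 'n = 20 and k = 9 and t = t] by (simp only:)
  qed
  finally show ?thesis .
qed

section \<open>The code of zero-sum nine-element subsets of Z/20\<close>

definition zero_sum_sets :: "20 set set" where
  "zero_sum_sets = {H. card H = 9 \<and> \<Sum>H = 0}"

lemma card_9_subsets: "card {B :: 20 set. card B = 9} = 167960"
proof -
  have "card {B :: 20 set. B \<subseteq> UNIV \<and> card B = 9} = 20 choose 9"
    by (subst n_subsets) auto
  then show ?thesis
    by (simp add: binomial_fact' fact_numeral)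
qed

text \<open>Arithmetic on the type \<open>20\<close> is modulo 20. Translation by \<open>c\<close>
  adds 9c to the sum of nine elements, and 9 is its own inverse, so the 20 sum classes have equal
  size 167960 / 20.\<close>

lemma card_zero_sum_sets: "card zero_sum_sets = 8398"
proof -
  define S where "S r = {H :: 20 set. card H = 9 \<and> \<Sum>H = r}" for r
  have shift: "(+) c ` H \<in> S (r + 9 * c)" if "H \<in> S r" for r c and H
    using that by (simp add: S_def card_image sum.reindex sum.distrib add.commute)
  have eq: "card (S r) = card (S 0)" for r
  proof -
    have inv: "9 * (9 * c) = c" for c :: 20
    proof -
      have "(9 :: 20) * 9 = 1"
        by simp
      then show ?thesis
        by (metis mult.assoc mult_1)
    qed
    have "bij_betw ((`) ((+) (9 * r))) (S 0) (S r)"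
    proof (rule bij_betw_byWitness[where f' = "(`) ((+) (- (9 * r)))"])
      show "(`) ((+) (9 * r)) ` S 0 \<subseteq> S r"
        using shift[of _ 0 "9 * r"] unfolding inv by auto
      show "(`) ((+) (- (9 * r))) ` S r \<subseteq> S 0"
        using shift[of _ r "- (9 * r)"] unfolding mult_minus_right inv by auto
    qed (auto simp: image_image)
    then show ?thesis
      by (metis bij_betw_same_card)
  qed
  have "(\<Union>r. S r) = {B. card B = 9}"
    by (auto simp: S_def)
  then have "167960 = card (\<Union>r. S r)"
    by (simp add: card_9_subsets)
  also have "\<dots> = (\<Sum>r\<in>UNIV. card (S r))"
    by (rule card_UN_disjoint) (auto simp: S_def)
  also have "\<dots> = (\<Sum>r\<in>(UNIV :: 20 set). card (S 0))"
    by (intro sum.cong refl eq)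
  finally have "card (S 0) = 8398"
    by simp
  then show ?thesis
    by (simp add: S_def zero_sum_sets_def)
qed

interpretation zero_sum: sparse_paving 9 zero_sum_sets
proof
  fix H H' assume H: "H \<in> zero_sum_sets" "H' \<in> zero_sum_sets" "H \<noteq> H'"
  have cards: "card H = 9" "card H' = 9"
    using H by (auto simp: zero_sum_sets_def)
  have "H \<inter> H' \<subset> H"
    using H cards card_subset_eq[of H' H] by auto
  then have "card (H \<inter> H') < 9"
    using psubset_card_mono[of H "H \<inter> H'"] cards by simp
  \<comment> \<open>Sets sharing eight elements differ by swapping \<open>a\<close> for
    \<open>b\<close>, and equal sums would force a = b.\<close>
  moreover have "card (H \<inter> H') \<noteq> 8"
  proof
    assume "card (H \<inter> H') = 8"
    then have "card (H - H') = 1" "card (H' - H) = 1"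
      using cards by (simp_all add: card_Diff_subset_Int Int_commute)
    then obtain a b where ab: "H - H' = {a}" "H' - H = {b}"
      by (meson card_1_singletonE)
    have "\<Sum>H = \<Sum>(H \<inter> H') + a" "\<Sum>H' = \<Sum>(H \<inter> H') + b"
      using sum.Int_Diff[of H "\<lambda>x. x" H'] sum.Int_Diff[of H' "\<lambda>x. x" H] ab
      by (simp_all add: Int_commute)
    then have "a = b"
      using H by (metis (mono_tags) add_left_imp_eq mem_Collect_eq zero_sum_sets_def)
    with ab show False
      by auto
  qed
  ultimately show "card (H \<inter> H') + 2 \<le> 9"
    by simp
qed (auto simp: zero_sum_sets_def)

lemma card_zero_sum_bases: "card zero_sum.bases = 159562"
proof -
  show ?thesis
    unfolding zero_sum.bases_def using card_zero_sum_sets card_9_subsets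
    by (subst card_Diff_subset) (auto simp: zero_sum_sets_def)
qed

section \<open>The Ehrhart polynomial and its negative quadratic coefficient\<close>

definition zero_sum_ehrhart_poly :: "real poly" where
  "zero_sum_ehrhart_poly = smult (1 / fact 19) (hypersimplex_poly - smult 8398 corner_poly)"

lemma is_ehrhart_poly_zero_sum:
  "is_ehrhart_poly (base_polytope zero_sum.bases) zero_sum_ehrhart_poly"
  unfolding is_ehrhart_poly_def
proof (intro conjI allI)
  have "degree zero_sum_ehrhart_poly = 19"
    unfolding zero_sum_ehrhart_poly_def hypersimplex_minus_corner_poly degree_smult_eq by simp
  then show "int (degree zero_sum_ehrhart_poly) = aff_dim (base_polytope zero_sum.bases)"
    by (simp add: zero_sum.aff_dim_base_polytope)
  fix t :: nat
  let ?C = "\<Sum>s<t. ((s + 8) choose 8) * ((s + 10) choose 10)"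
  have "card ((*\<^sub>R) (real t) ` base_polytope zero_sum.bases \<inter> lattice_points) + 8398 * ?C =
      card {y :: 20 \<Rightarrow> nat. (\<forall>i. y i \<le> t) \<and> sum y UNIV = 9 * t}"
  proof -
    have eqs: "(9 :: nat) - 1 = 8" "CARD(20) - 9 - 1 = 10"
      "s + 9 - 1 = s + 8" "s + CARD(20) - 9 - 1 = s + 10" for s :: nat
      by simp_all
    show ?thesis
      using zero_sum.card_lattice_points_eq[of t] by (simp only: eqs card_zero_sum_sets)
  qed
  then have count: "real (card {y :: 20 \<Rightarrow> nat. (\<forall>i. y i \<le> t) \<and> sum y UNIV = 9 * t}) - 8398 * real ?C =
      real (card ((*\<^sub>R) (real t) ` base_polytope zero_sum.bases \<inter> lattice_points))"
  proof -
    have "real b - 8398 * real c = real a" if "a + 8398 * c = b" for a b c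
      using that by auto
    then show ?thesis
      using \<open>_ + 8398 * ?C = _\<close> by blast
  qed
  have corner: "poly corner_poly (real t) = fact 19 * real ?C"
    by (simp only: poly_corner_poly of_nat_sum of_nat_mult)
  have scale: "1 / fact 19 * (fact 19 * a - 8398 * (fact 19 * b)) = a - 8398 * b" for a b :: real
    by (simp add: field_simps)
  show "poly zero_sum_ehrhart_poly (real t) =
      real (card ((*\<^sub>R) (real t) ` base_polytope zero_sum.bases \<inter> lattice_points))"
    by (simp only: zero_sum_ehrhart_poly_def poly_smult poly_diff poly_hypersimplex_poly corner
        scale count)
qed

theorem theorem1p5:
  "\<exists>\<B> :: 20 set set.
     matroid (UNIV :: 20 set) \<B> \<and>
     matroid_connected (UNIV :: 20 set) \<B> \<and>
     matroid_rank (UNIV :: 20 set) \<B> = 9 \<and>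
     card \<B> = 159562 \<and>
     \<not> ehrhart_positive (base_polytope \<B>)"
proof (intro exI conjI)
  have "ehrhart_poly (base_polytope zero_sum.bases) = zero_sum_ehrhart_poly"
    unfolding ehrhart_poly_def
    using is_ehrhart_poly_zero_sum is_ehrhart_poly_unique by blast
  \<comment> \<open>The value is -1120329305412756480 / 19!, about -9.2.\<close>
  moreover have "coeff zero_sum_ehrhart_poly 2 < 0"
    by (simp add: zero_sum_ehrhart_poly_def hypersimplex_minus_corner_poly numeral_2_eq_2
        divide_less_0_iff)
  ultimately show "\<not> ehrhart_positive (base_polytope zero_sum.bases)"
    by (auto simp: ehrhart_positive_def zero_sum.aff_dim_base_polytope not_less intro!: exI[of _ 2])
qed (rule zero_sum.matroid_bases zero_sum.matroid_connected_bases zero_sum.matroid_rank_bases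
    card_zero_sum_bases)+

end
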